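(* $\mathsf{COH}\le_\mathrm{sW}\mathsf{wRSg}$.
   Context: Problems are multi-valued partial functions $\subseteq\omega^\omega\rightrightarrows\omega^\omega$ with standard codings. $\mathcal{F}\le_\mathrm{sW}\mathcal{G}$ if there are Turing functionals $\Phi,\Psi$ with $\Phi(f)\in\mathrm{dom}(\mathcal{G})$ for all $f\in\mathrm{dom}(\mathcal{F})$ and $\Psi(g)\in\mathcal{F}(f)$ for all $f\in\mathrm{dom}(\mathcal F)$, $g\in\mathcal{G}(\Phi(f))$. $\mathsf{COH}$: input a sequence $(A_i:i\in\omega)$ of subsets of $\omega$; output an infinite $C\subseteq\omega$ such that for each $i$, $C\setminus A_i$ is finite or $C\cap A_i$ is finite. Graphs $G=(V,E)$ are simple with $V\subseteq\omega$ infinite, $E\subseteq[V]^2$; $N(v)=\{y:(v,y)\in E\}$. $\mathsf{wRSg}$: input an infinite graph $G=(V,E)$; output an infinite $H\subseteq V$ with, for all $v\in H$, $|H\cap N(v)|=\omega$ or $|H\cap N(v)|\le1$. *)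

theory Defs
  imports Complex_Main "HOL-Library.Nat_Bijection" "HOL-Library.Ramsey"
begin

text \<open>
  Turing functionals are presented by Kleene's schemes for the partial recursive functions
  relative to an oracle. Programs carry no arity; an ill-typed application (too few arguments)
  diverges.
\<close>

datatype program =
    Zero
  | Succ
  | Proj nat
  | Oracle
  | Comp program "program list"
  | PrimRec program program
  | Mu program

text \<open>
  In the equation for \<open>Comp\<close>, \<open>those\<close> returns \<open>None\<close> if one of the inner computations diverges.
  In the equation for \<open>Mu\<close>, all values below the least zero have to be defined.
\<close>

fun eval :: "(nat \<Rightarrow> nat) \<Rightarrow> program \<Rightarrow> nat list \<Rightarrow> nat option" where
  "eval f Zero xs = Some 0"
| "eval f Succ xs = (case xs of [] \<Rightarrow> None | x # _ \<Rightarrow> Some (Suc x))"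
| "eval f (Proj i) xs = (if i < length xs then Some (xs ! i) else None)"
| "eval f Oracle xs = (case xs of [] \<Rightarrow> None | x # _ \<Rightarrow> Some (f x))"
| "eval f (Comp p qs) xs =
    (case those (map (\<lambda>q. eval f q xs) qs) of None \<Rightarrow> None | Some ys \<Rightarrow> eval f p ys)"
| "eval f (PrimRec p q) xs =
    (case xs of
      [] \<Rightarrow> None
    | n # zs \<Rightarrow>
        rec_nat (eval f p zs)
          (\<lambda>m r. case r of None \<Rightarrow> None | Some y \<Rightarrow> eval f q (m # y # zs)) n)"
| "eval f (Mu p) xs =
    (if \<exists>n. eval f p (n # xs) = Some 0 \<and> (\<forall>m<n. eval f p (m # xs) \<noteq> None)
     then Some (LEAST n. eval f p (n # xs) = Some 0)
     else None)"

definition turing_functional :: "((nat \<Rightarrow> nat) \<Rightarrow> nat \<rightharpoonup> nat) \<Rightarrow> bool" where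
  "turing_functional \<Phi> \<longleftrightarrow> (\<exists>p. \<forall>f n. \<Phi> f n = eval f p [n])"

text \<open>A problem maps each instance to the set of its solutions, and non-instances to the empty set.\<close>

type_synonym problem = "(nat \<Rightarrow> nat) \<Rightarrow> (nat \<Rightarrow> nat) set"

definition pdom :: "problem \<Rightarrow> (nat \<Rightarrow> nat) set" where
  "pdom F = {f. F f \<noteq> {}}"

text \<open>\<open>\<Phi> f = Some \<circ> g\<close> says that \<open>\<Phi>(f)\<close> is total, with value \<open>g\<close>.\<close>

definition sW_reducible :: "problem \<Rightarrow> problem \<Rightarrow> bool"  (infix \<open>\<le>\<^sub>s\<^sub>W\<close> 50) where
  "F \<le>\<^sub>s\<^sub>W G \<longleftrightarrow>
    (\<exists>\<Phi> \<Psi>. turing_functional \<Phi> \<and> turing_functional \<Psi> \<and>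
      (\<forall>f \<in> pdom F. \<exists>g \<in> pdom G. \<Phi> f = Some \<circ> g \<and>
        (\<forall>h \<in> G g. \<exists>k \<in> F f. \<Psi> h = Some \<circ> k)))"

definition char_fun :: "nat set \<Rightarrow> nat \<Rightarrow> nat" where
  "char_fun A n = of_bool (n \<in> A)"

definition join :: "(nat \<Rightarrow> nat) \<Rightarrow> (nat \<Rightarrow> nat) \<Rightarrow> nat \<Rightarrow> nat" where
  "join f g n = (if even n then f (n div 2) else g (n div 2))"

definition seq_code :: "(nat \<Rightarrow> nat set) \<Rightarrow> nat \<Rightarrow> nat" where
  "seq_code A = char_fun {prod_encode (i, n) | i n. n \<in> A i}"

definition COH :: problem where
  "COH f =
    {char_fun C | C A. f = seq_code A \<and> infinite C \<and>
      (\<forall>i. finite (C - A i) \<or> finite (C \<inter> A i))}"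

text \<open>Edges are two-element sets of vertices; the edge set is coded as a symmetric set of pairs.\<close>

definition inf_graph :: "nat set \<Rightarrow> nat set set \<Rightarrow> bool" where
  "inf_graph V E \<longleftrightarrow> infinite V \<and> E \<subseteq> [V]\<^bsup>2\<^esup>"

definition nbhd :: "nat set set \<Rightarrow> nat \<Rightarrow> nat set" where
  "nbhd E v = {y. {v, y} \<in> E}"

definition graph_code :: "nat set \<Rightarrow> nat set set \<Rightarrow> nat \<Rightarrow> nat" where
  "graph_code V E = join (char_fun V) (char_fun {prod_encode (x, y) | x y. {x, y} \<in> E})"

definition wRSg :: problem where
  "wRSg g =
    {char_fun H | H V E. inf_graph V E \<and> g = graph_code V E \<and> infinite H \<and> H \<subseteq> V \<and>
      (\<forall>v \<in> H. infinite (H \<inter> nbhd E v) \<or> card (H \<inter> nbhd E v) \<le> 1)}"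

end

theory Submission
  imports Defs
begin

text \<open>
  Given sets \<open>A\<^sub>0, A\<^sub>1, \<dots>\<close>, let \<open>r(x)\<close> be the dyadic rational with binary digits
  \<open>A\<^sub>0(x) \<dots> A\<^sub>x(x)\<close>, and join \<open>x < y\<close> by an edge iff \<open>r(x) < r(y)\<close>. A set along which \<open>r\<close> is
  eventually monotone is cohesive, because then every truncation of \<open>r\<close> stabilises.

  Let \<open>S\<close> be a solution of this graph, and call \<open>d \<in> S\<close> a hub if it has two smaller neighbours in
  \<open>S\<close>; a hub has infinitely many neighbours in \<open>S\<close>. If there is no hub, then at most one element of
  \<open>S\<close> has infinitely many neighbours in \<open>S\<close>, so that for each other \<open>y \<in> S\<close> we have \<open>r(z) \<le> r(y)\<close>
  for almost all \<open>z \<in> S\<close>, and \<open>S\<close> itself is cohesive. If \<open>d\<close> is the first hub, then every later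
  \<open>x \<in> S\<close> with \<open>r(x) > r(d)\<close> is a hub as well, so the successive strict maxima of \<open>r\<close> on \<open>S\<close> from
  \<open>d\<close> on never end, and they form a cohesive set. Since the second set agrees with \<open>S\<close> below \<open>d\<close>,
  a single procedure handles both cases. The reduction is strong because the vertex for \<open>x\<close> is
  taken to be a code of the pair \<open>(x, r(x))\<close>.
\<close>

section \<open>Total computable functionals\<close>

text \<open>Totality for every oracle is enough: both functionals of the reduction search only below
  explicit bounds, so \<open>Mu\<close> never occurs and no divergence has to be tracked.\<close>

definition computable :: "nat \<Rightarrow> ((nat \<Rightarrow> nat) \<Rightarrow> nat list \<Rightarrow> nat) \<Rightarrow> bool" where
  "computable k F \<longleftrightarrow> (\<exists>p. \<forall>f xs. length xs = k \<longrightarrow> eval f p xs = Some (F f xs))"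

abbreviation decidable :: "nat \<Rightarrow> ((nat \<Rightarrow> nat) \<Rightarrow> nat list \<Rightarrow> bool) \<Rightarrow> bool" where
  "decidable k P \<equiv> computable k (\<lambda>f xs. of_bool (P f xs))"

lemma those_map_Some: "those (map (\<lambda>x. Some (g x)) xs) = Some (map g xs)"
  by (induction xs) auto

lemma those_map_Proj:
  assumes "length xs = k"
  shows "those (map (\<lambda>q. eval f q xs) (map Proj [0..<k])) = Some xs"
proof -
  have "map (\<lambda>q. eval f q xs) (map Proj [0..<k]) = map (\<lambda>i. Some (xs ! i)) [0..<k]"
    using assms by auto
  then show ?thesis
    using map_nth[of xs] assms by (simp only: those_map_Some)
qed

named_theorems computable_intros

lemma computable_hd [computable_intros]: "0 < k \<Longrightarrow> computable k (\<lambda>f xs. hd xs)"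
  unfolding computable_def by (rule exI[of _ "Proj 0"]) (auto simp: hd_conv_nth)

lemma computable_hd_tl [computable_intros]: "1 < k \<Longrightarrow> computable k (\<lambda>f xs. hd (tl xs))"
  unfolding computable_def
  by (rule exI[of _ "Proj 1"]) (auto simp: hd_conv_nth nth_tl simp flip: length_greater_0_conv)

lemma computable_hd_tl_tl [computable_intros]:
  "2 < k \<Longrightarrow> computable k (\<lambda>f xs. hd (tl (tl xs)))"
  unfolding computable_def
  by (rule exI[of _ "Proj 2"])
    (auto simp: hd_conv_nth nth_tl numeral_2_eq_2 simp flip: length_greater_0_conv)

lemma computable_hd_tl_tl_tl [computable_intros]:
  "3 < k \<Longrightarrow> computable k (\<lambda>f xs. hd (tl (tl (tl xs))))"
  unfolding computable_def
  by (rule exI[of _ "Proj 3"])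
    (auto simp: hd_conv_nth nth_tl numeral_3_eq_3 simp flip: length_greater_0_conv)

lemma computable_hd_tl_tl_tl_tl [computable_intros]:
  "4 < k \<Longrightarrow> computable k (\<lambda>f xs. hd (tl (tl (tl (tl xs)))))"
  unfolding computable_def
  by (rule exI[of _ "Proj 4"])
    (auto simp: hd_conv_nth nth_tl eval_nat_numeral simp flip: length_greater_0_conv)

lemma computable_0: "computable k (\<lambda>f xs. 0)"
  unfolding computable_def by (rule exI[of _ Zero]) auto

lemma computable_Suc [computable_intros]:
  assumes "computable k a"
  shows "computable k (\<lambda>f xs. Suc (a f xs))"
proof -
  obtain p where "\<And>f xs. length xs = k \<Longrightarrow> eval f p xs = Some (a f xs)"
    using assms unfolding computable_def by blast
  then show ?thesis
    unfolding computable_def by (intro exI[of _ "Comp Succ [p]"]) simp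
qed

lemma computable_const [computable_intros]: "computable k (\<lambda>f xs. c)"
  by (induction c) (auto intro: computable_0 computable_Suc)

lemma computable_oracle [computable_intros]:
  assumes "computable k a"
  shows "computable k (\<lambda>f xs. f (a f xs))"
proof -
  obtain p where "\<And>f xs. length xs = k \<Longrightarrow> eval f p xs = Some (a f xs)"
    using assms unfolding computable_def by blast
  then show ?thesis
    unfolding computable_def by (intro exI[of _ "Comp Oracle [p]"]) simp
qed

text \<open>Premises of binding rules access bound variables through \<open>hd\<close> and \<open>tl\<close>, so that the
  conclusions are higher-order patterns and the rules can be applied by resolution.\<close>

lemma computable_rec_nat [computable_intros]:
  assumes "computable k b" "computable k a"
    and "computable (Suc (Suc k)) (\<lambda>f ys. s f (hd ys) (hd (tl ys)) (tl (tl ys)))"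
  shows "computable k (\<lambda>f xs. rec_nat (a f xs) (\<lambda>m r. s f m r xs) (b f xs))"
proof -
  obtain pb where pb: "\<And>f xs. length xs = k \<Longrightarrow> eval f pb xs = Some (b f xs)"
    using assms(1) unfolding computable_def by blast
  obtain pa where pa: "\<And>f xs. length xs = k \<Longrightarrow> eval f pa xs = Some (a f xs)"
    using assms(2) unfolding computable_def by blast
  obtain ps where ps: "\<And>f ys. length ys = Suc (Suc k) \<Longrightarrow>
      eval f ps ys = Some (s f (hd ys) (hd (tl ys)) (tl (tl ys)))"
    using assms(3) unfolding computable_def by blast
  have "eval f (Comp (PrimRec pa ps) (pb # map Proj [0..<k])) xs =
      Some (rec_nat (a f xs) (\<lambda>m r. s f m r xs) (b f xs))" if len: "length xs = k" for f xs
  proof -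
    have "rec_nat (eval f pa xs)
        (\<lambda>m r. case r of None \<Rightarrow> None | Some y \<Rightarrow> eval f ps (m # y # xs)) n =
        Some (rec_nat (a f xs) (\<lambda>m r. s f m r xs) n)" for n
      by (induction n) (auto simp: pa ps len)
    then show ?thesis
      using those_map_Proj[OF len, of f] pb[OF len] by simp
  qed
  then show ?thesis
    unfolding computable_def by blast
qed

lemma computable_comp1:
  assumes "computable 1 (\<lambda>f xs. g f (hd xs))" "computable k a"
  shows "computable k (\<lambda>f xs. g f (a f xs))"
proof -
  obtain p where "\<And>f xs. length xs = 1 \<Longrightarrow> eval f p xs = Some (g f (hd xs))"
    using assms(1) unfolding computable_def by blast
  moreover obtain pa where "\<And>f xs. length xs = k \<Longrightarrow> eval f pa xs = Some (a f xs)"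
    using assms(2) unfolding computable_def by blast
  ultimately show ?thesis
    unfolding computable_def by (intro exI[of _ "Comp p [pa]"]) simp
qed

lemma computable_comp2:
  assumes "computable 2 (\<lambda>f xs. g f (hd xs) (hd (tl xs)))" "computable k a" "computable k b"
  shows "computable k (\<lambda>f xs. g f (a f xs) (b f xs))"
proof -
  obtain p where "\<And>f xs. length xs = 2 \<Longrightarrow> eval f p xs = Some (g f (hd xs) (hd (tl xs)))"
    using assms(1) unfolding computable_def by blast
  moreover obtain pa where "\<And>f xs. length xs = k \<Longrightarrow> eval f pa xs = Some (a f xs)"
    using assms(2) unfolding computable_def by blast
  moreover obtain pb where "\<And>f xs. length xs = k \<Longrightarrow> eval f pb xs = Some (b f xs)"
    using assms(3) unfolding computable_def by blast
  ultimately show ?thesis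
    unfolding computable_def by (intro exI[of _ "Comp p [pa, pb]"]) simp
qed

section \<open>Arithmetic\<close>

lemma computable_add [computable_intros]:
  assumes "computable k a" "computable k b"
  shows "computable k (\<lambda>f xs. a f xs + b f xs)"
proof -
  have "m + n = rec_nat m (\<lambda>_ r. Suc r) n" for m n :: nat
    by (induction n) auto
  then have "computable 2 (\<lambda>f xs. hd xs + hd (tl xs))"
    by (simp only:) (intro computable_intros; simp)
  from computable_comp2[OF this assms] show ?thesis .
qed

lemma computable_mult [computable_intros]:
  assumes "computable k a" "computable k b"
  shows "computable k (\<lambda>f xs. a f xs * b f xs)"
proof -
  have "m * n = rec_nat 0 (\<lambda>_ r. r + m) n" for m n :: nat
    by (induction n) auto
  then have "computable 2 (\<lambda>f xs. hd xs * hd (tl xs))"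
    by (simp only:) (intro computable_intros; simp)
  from computable_comp2[OF this assms] show ?thesis .
qed

lemma computable_pow2 [computable_intros]:
  assumes "computable k a"
  shows "computable k (\<lambda>f xs. 2 ^ a f xs)"
proof -
  have "2 ^ n = rec_nat (1 :: nat) (\<lambda>_ r. r + r) n" for n :: nat
    by (induction n) auto
  then have "computable 1 (\<lambda>f xs. 2 ^ hd xs)"
    by (simp only:) (intro computable_intros; simp)
  from computable_comp1[OF this assms] show ?thesis .
qed

lemma computable_diff [computable_intros]:
  assumes "computable k a" "computable k b"
  shows "computable k (\<lambda>f xs. a f xs - b f xs)"
proof -
  \<comment> \<open>The recursion returns the last index rather than the previous value; iterating
    this predecessor gives truncated subtraction.\<close>
  have "n - 1 = rec_nat 0 (\<lambda>m _. m) n" for n :: nat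
    by (induction n) auto
  then have "computable 1 (\<lambda>f xs. hd xs - 1)"
    by (simp only:) (intro computable_intros; simp)
  note pred = computable_comp1[OF this]
  have "rec_nat m (\<lambda>_ r. r - 1) n = m - n" for m n :: nat
    by (induction n) auto
  moreover have "computable 2 (\<lambda>f xs. rec_nat (hd xs) (\<lambda>_ r. r - 1) (hd (tl xs)))"
    by (intro computable_intros pred; simp)
  ultimately have "computable 2 (\<lambda>f xs. hd xs - hd (tl xs))"
    by (simp only:)
  from computable_comp2[OF this assms] show ?thesis .
qed

lemma computable_prod_encode [computable_intros]:
  assumes "computable k a" "computable k b"
  shows "computable k (\<lambda>f xs. prod_encode (a f xs, b f xs))"
proof -
  have "triangle n = rec_nat 0 (\<lambda>m r. r + Suc m) n" for n
    by (induction n) auto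
  then have "computable 1 (\<lambda>f xs. triangle (hd xs))"
    by (simp only:) (intro computable_intros; simp)
  note triangle = computable_comp1[OF this]
  show ?thesis
    unfolding prod_encode_def prod.case by (intro computable_add triangle assms)
qed

lemma computable_sum [computable_intros]:
  assumes "computable k b" "computable (Suc k) (\<lambda>f ys. s f (hd ys) (tl ys))"
  shows "computable k (\<lambda>f xs. \<Sum>z<b f xs. s f z xs)"
proof -
  obtain p where p: "\<And>f ys. length ys = Suc k \<Longrightarrow> eval f p ys = Some (s f (hd ys) (tl ys))"
    using assms(2) unfolding computable_def by blast
  \<comment> \<open>A recursion step receives index, accumulator and parameters. The projections
    skip position 1, the accumulator, on which the summand does not depend.\<close>
  have "eval f (Comp p (Proj 0 # map Proj [2..<Suc (Suc k)])) ys = Some (s f (hd ys) (tl (tl ys)))"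
    if len: "length ys = Suc (Suc k)" for f ys
  proof -
    obtain u v xs where ys: "ys = u # v # xs" "length xs = k"
      using len by (metis Suc_length_conv)
    have "map (\<lambda>q. eval f q ys) (map Proj [2..<Suc (Suc k)]) =
        map (\<lambda>q. eval f q xs) (map Proj [0..<k])"
      by (rule nth_equalityI) (auto simp: ys nth_append simp del: upt_Suc)
    then show ?thesis
      using those_map_Proj[OF ys(2), of f] ys by (simp add: p del: upt_Suc)
  qed
  then have step: "computable (Suc (Suc k)) (\<lambda>f ys. s f (hd ys) (tl (tl ys)))"
    unfolding computable_def by blast
  have "(\<Sum>z<n. g z) = rec_nat 0 (\<lambda>m r. r + g m) n" for n :: nat and g :: "nat \<Rightarrow> nat"
    by (induction n) auto
  then show ?thesis
    by (simp only:) (intro computable_rec_nat computable_add computable_hd_tl computable_const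
        assms(1) step; simp)
qed

section \<open>Decidable predicates\<close>

lemma decidable_le [computable_intros]:
  assumes "computable k a" "computable k b"
  shows "decidable k (\<lambda>f xs. a f xs \<le> b f xs)"
proof -
  have "of_bool (m \<le> n) = 1 - (m - n)" for m n :: nat
    by (cases "m \<le> n") auto
  then show ?thesis
    by (simp only:) (intro computable_intros assms)
qed

lemma decidable_less [computable_intros]:
  assumes "computable k a" "computable k b"
  shows "decidable k (\<lambda>f xs. a f xs < b f xs)"
  unfolding less_eq_Suc_le by (intro computable_intros assms)

lemma decidable_not [computable_intros]:
  assumes "decidable k P"
  shows "decidable k (\<lambda>f xs. \<not> P f xs)"
proof -
  have "of_bool (\<not> p) = (1 :: nat) - of_bool p" for p
    by simp
  then show ?thesis
    by (simp only:) (intro computable_intros assms)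
qed

lemma decidable_conj [computable_intros]:
  assumes "decidable k P" "decidable k Q"
  shows "decidable k (\<lambda>f xs. P f xs \<and> Q f xs)"
  unfolding of_bool_conj by (intro computable_intros assms)

lemma decidable_disj [computable_intros]:
  assumes "decidable k P" "decidable k Q"
  shows "decidable k (\<lambda>f xs. P f xs \<or> Q f xs)"
proof -
  have "decidable k (\<lambda>f xs. \<not> (\<not> P f xs \<and> \<not> Q f xs))"
    by (intro computable_intros assms)
  then show ?thesis by (simp only: de_Morgan_conj not_not)
qed

lemma decidable_imp [computable_intros]:
  assumes "decidable k P" "decidable k Q"
  shows "decidable k (\<lambda>f xs. P f xs \<longrightarrow> Q f xs)"
  unfolding imp_conv_disj by (intro computable_intros assms)

lemma decidable_eq [computable_intros]:
  assumes "computable k a" "computable k b"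
  shows "decidable k (\<lambda>f xs. a f xs = b f xs)"
  unfolding order_eq_iff by (intro computable_intros assms)

lemma decidable_ex_less [computable_intros]:
  assumes "computable k b" "decidable (Suc k) (\<lambda>f ys. P f (hd ys) (tl ys))"
  shows "decidable k (\<lambda>f xs. \<exists>z<b f xs. P f z xs)"
proof -
  have "(\<exists>z<n. p z) \<longleftrightarrow> 0 < (\<Sum>z<n. of_bool (p z) :: nat)" for n :: nat and p
    by (auto simp flip: neq0_conv)
  then show ?thesis
    by (simp only:) (intro computable_intros assms)
qed

lemma decidable_all_less [computable_intros]:
  assumes "computable k b" "decidable (Suc k) (\<lambda>f ys. P f (hd ys) (tl ys))"
  shows "decidable k (\<lambda>f xs. \<forall>z<b f xs. P f z xs)"
proof -
  have "decidable k (\<lambda>f xs. \<not> (\<exists>z<b f xs. \<not> P f z xs))"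
    by (intro computable_intros assms)
  then show ?thesis by (simp only: not_ex de_Morgan_conj not_not imp_conv_disj)
qed

lemma turing_functional_if_computable:
  assumes "computable 1 (\<lambda>f xs. g f (hd xs))"
  shows "turing_functional (\<lambda>f n. Some (g f n))"
proof -
  obtain p where "\<And>f xs. length xs = 1 \<Longrightarrow> eval f p xs = Some (g f (hd xs))"
    using assms unfolding computable_def by blast
  then show ?thesis
    unfolding turing_functional_def by (intro exI[of _ p]) simp
qed

section \<open>Thinning a solution\<close>

definition nbrs :: "(nat \<Rightarrow> real) \<Rightarrow> nat \<Rightarrow> nat set" where
  "nbrs r x = {y. x < y \<and> r x < r y \<or> y < x \<and> r y < r x}"

definition hub :: "nat set \<Rightarrow> (nat \<Rightarrow> real) \<Rightarrow> nat \<Rightarrow> bool" where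
  "hub S r d \<longleftrightarrow> d \<in> S \<and> (\<exists>a\<in>S. \<exists>b\<in>S. b < a \<and> a < d \<and> r a < r d \<and> r b < r d)"

text \<open>From the first hub on, these are the strict records of \<open>r\<close> on
  \<open>S\<close>; before it the condition is vacuous. Membership of \<open>y\<close> depends only
  on \<open>S\<close> and \<open>r\<close> up to \<open>y\<close>, so nothing has to decide whether
  a hub exists.\<close>

definition thin :: "nat set \<Rightarrow> (nat \<Rightarrow> real) \<Rightarrow> nat set" where
  "thin S r = {y \<in> S. \<forall>z\<in>S. z < y \<and> (\<exists>d\<le>z. hub S r d) \<longrightarrow> r z < r y}"

lemma nbr_above_if_infinite:
  assumes "infinite (S \<inter> nbrs r x)"
  obtains y where "y \<in> S" "n < y" "x < y" "r x < r y"
proof -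
  obtain y where "y \<in> S \<inter> nbrs r x" "max n x < y"
    using assms unfolding infinite_nat_iff_unbounded by blast
  then show ?thesis
    using that by (auto simp: nbrs_def)
qed

text \<open>Whichever of \<open>x\<close> and \<open>y\<close> has the larger \<open>r\<close>, it
  has a neighbour beyond \<open>y\<close> with still larger \<open>r\<close>, and \<open>x\<close>
  and \<open>y\<close> make that neighbour a hub.\<close>

lemma infinite_nbrs_unique_if_no_hub:
  assumes no_hub: "\<And>d. \<not> hub S r d" and "x \<in> S" "y \<in> S" "x < y"
    and "infinite (S \<inter> nbrs r x)" "infinite (S \<inter> nbrs r y)"
  shows False
proof -
  obtain u where u: "u \<in> S" "y < u" "r x < r u"
    using nbr_above_if_infinite[OF assms(5)] by blast
  obtain v where v: "v \<in> S" "y < v" "r y < r v"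
    using nbr_above_if_infinite[OF assms(6)] by blast
  show False
  proof (cases "r x \<le> r y")
    case True
    then have "hub S r v"
      using v assms(2-4) unfolding hub_def by force
    then show False using no_hub by blast
  next
    case False
    then have "hub S r u"
      using u assms(2-4) unfolding hub_def by force
    then show False using no_hub by blast
  qed
qed

text \<open>Set aside the elements below \<open>N\<close> and the at most one with infinitely many
  neighbours, and minimise \<open>g\<close> on the rest. Almost every element has \<open>r\<close>
  at most that of the minimiser, so monotonicity and minimality force equal values of
  \<open>g\<close>.\<close>

lemma eventually_constant_if_no_hub:
  fixes g :: "nat \<Rightarrow> nat"
  assumes no_hub: "\<And>d. \<not> hub S r d" and "infinite S"
    and mono: "\<And>x y. N \<le> x \<Longrightarrow> N \<le> y \<Longrightarrow> r x \<le> r y \<Longrightarrow> g x \<le> g y"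
  shows "\<exists>c. finite {x \<in> S. g x \<noteq> c}"
proof -
  define I where "I = {x \<in> S. infinite (S \<inter> nbrs r x)}"
  define T where "T = {x \<in> S. N \<le> x \<and> x \<notin> I}"
  have "x = y" if "x \<in> I" "y \<in> I" for x y
    using that infinite_nbrs_unique_if_no_hub[OF no_hub, where x = x and y = y]
      infinite_nbrs_unique_if_no_hub[OF no_hub, where x = y and y = x]
    by (cases x y rule: linorder_cases) (auto simp: I_def)
  then have "I = {} \<or> (\<exists>x. I = {x})"
    by blast
  then have "finite I"
    by auto
  moreover have "S - T \<subseteq> I \<union> {..<N}"
    by (auto simp: T_def)
  ultimately have fin: "finite (S - T)"
    by (simp add: finite_subset)
  then have "T \<noteq> {}"
    using \<open>infinite S\<close> by auto
  then obtain y where y: "y \<in> T" "\<And>z. z \<in> T \<Longrightarrow> g y \<le> g z"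
    using ex_has_least_nat[of "\<lambda>x. x \<in> T" _ g] by blast
  have "{x \<in> S. g x \<noteq> g y} \<subseteq> (S - T) \<union> {..y} \<union> (S \<inter> nbrs r y)"
  proof
    fix x assume x: "x \<in> {x \<in> S. g x \<noteq> g y}"
    show "x \<in> (S - T) \<union> {..y} \<union> (S \<inter> nbrs r y)"
    proof (rule ccontr)
      assume "x \<notin> (S - T) \<union> {..y} \<union> (S \<inter> nbrs r y)"
      with x have "x \<in> T" "r x \<le> r y"
        by (auto simp: nbrs_def)
      with y mono[of x y] have "g x = g y"
        by (auto simp: T_def intro: antisym)
      with x show False by simp
    qed
  qed
  moreover have "finite (S \<inter> nbrs r y)"
    using y(1) by (auto simp: T_def I_def)
  ultimately show ?thesis
    using fin by (meson finite_Un finite_atMost finite_subset)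
qed

lemma thin_increasing:
  assumes "hub S r d" "x \<in> thin S r" "y \<in> thin S r" "d \<le> x" "x < y"
  shows "r x < r y"
  using assms unfolding thin_def by blast

text \<open>Past the hub \<open>r\<close> increases along \<open>thin S r\<close>, so
  \<open>g\<close> is eventually nondecreasing there and, being bounded, stays constant once its
  maximum is reached.\<close>

lemma eventually_constant_on_thin:
  fixes g :: "nat \<Rightarrow> nat"
  assumes "hub S r d" and inf: "infinite (thin S r)"
    and mono: "\<And>x y. N \<le> x \<Longrightarrow> N \<le> y \<Longrightarrow> r x \<le> r y \<Longrightarrow> g x \<le> g y"
    and bound: "\<And>x. g x \<le> B"
  shows "\<exists>c. finite {x \<in> thin S r. g x \<noteq> c}"
proof -
  define T where "T = {x \<in> thin S r. d \<le> x \<and> N \<le> x}"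
  obtain t where "t \<in> thin S r" "max d N < t"
    using inf unfolding infinite_nat_iff_unbounded by blast
  then have "t \<in> T"
    by (simp add: T_def)
  then obtain y where y: "y \<in> T" "\<And>z. z \<in> T \<Longrightarrow> g z \<le> g y"
    using ex_has_greatest_nat[of "\<lambda>x. x \<in> T" t g "Suc B"] bound by (auto simp: less_Suc_eq_le)
  have "g x = g y" if "x \<in> T" "y < x" for x
    using y that thin_increasing[OF assms(1), of y x] mono[of y x]
    by (auto simp: T_def intro: antisym)
  then have "{x \<in> thin S r. g x \<noteq> g y} \<subseteq> {..max y (max d N)}"
    by (force simp: T_def not_le)
  then show ?thesis
    using finite_subset by blast
qed

text \<open>The two elements that witness a hub are neighbours of it, which rules out the
  alternative of at most one neighbour.\<close>

lemma infinite_nbrs_if_hub: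
  assumes "\<And>x. x \<in> S \<Longrightarrow> infinite (S \<inter> nbrs r x) \<or> card (S \<inter> nbrs r x) \<le> 1" "hub S r d"
  shows "infinite (S \<inter> nbrs r d)"
proof
  assume fin: "finite (S \<inter> nbrs r d)"
  obtain a b where ab: "a \<in> S" "b \<in> S" "b < a" "a < d" "r a < r d" "r b < r d"
    using assms(2) unfolding hub_def by blast
  then have "card {a, b} \<le> card (S \<inter> nbrs r d)"
    by (intro card_mono fin) (auto simp: nbrs_def)
  with ab assms fin show False
    by (force simp: hub_def)
qed

text \<open>In a finite set the last element \<open>x\<close> would inherit the witnesses of the
  first hub \<open>d\<close>, as \<open>r x\<close> is not below \<open>r d\<close>. Being a hub,
  \<open>x\<close> has later neighbours of larger \<open>r\<close>, and the first of them is a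
  further record.\<close>

lemma infinite_thin_if_hub:
  assumes sol: "\<And>x. x \<in> S \<Longrightarrow> infinite (S \<inter> nbrs r x) \<or> card (S \<inter> nbrs r x) \<le> 1"
    and "hub S r d'"
  shows "infinite (thin S r)"
proof
  assume fin: "finite (thin S r)"
  obtain d where d: "hub S r d" "\<And>e. hub S r e \<Longrightarrow> d \<le> e"
    using ex_has_least_nat[of "hub S r" d' id] assms(2) by auto
  have "d \<in> S"
    using d(1) by (simp add: hub_def)
  then have "d \<in> thin S r"
    by (auto simp: thin_def dest: d(2))
  define x where "x = Max (thin S r)"
  have x: "x \<in> thin S r" "d \<le> x" and x_max: "\<And>y. y \<in> thin S r \<Longrightarrow> y \<le> x"
    using fin \<open>d \<in> thin S r\<close> by (auto simp: x_def intro: Max_in)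
  have "hub S r x"
  proof (cases "x = d")
    case False
    then have "r d < r x"
      using thin_increasing[OF d(1) \<open>d \<in> thin S r\<close> x(1)] x(2) by auto
    obtain a b where "a \<in> S" "b \<in> S" "b < a" "a < d" "r a < r d" "r b < r d"
      using d(1) unfolding hub_def by blast
    moreover from this \<open>r d < r x\<close> x have "a < x" "r a < r x" "r b < r x" "x \<in> S"
      by (auto simp: thin_def)
    ultimately show ?thesis
      unfolding hub_def by blast
  qed (use d in simp)
  then have "infinite (S \<inter> nbrs r x)"
    using infinite_nbrs_if_hub[OF sol] by blast
  then obtain y' where "y' \<in> S \<and> x < y' \<and> r x < r y'"
    using nbr_above_if_infinite by metis
  then obtain y where y: "y \<in> S" "x < y" "r x < r y"
    and y_min: "\<And>z. z \<in> S \<Longrightarrow> x < z \<Longrightarrow> r x < r z \<Longrightarrow> y \<le> z"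
    using ex_has_least_nat[of "\<lambda>y. y \<in> S \<and> x < y \<and> r x < r y" y' id] by auto
  \<comment> \<open>Before \<open>x\<close> the record property of \<open>x\<close> bounds
    \<open>r z\<close>; between \<open>x\<close> and \<open>y\<close> the minimality of
    \<open>y\<close> does.\<close>
  have "r z < r y" if z: "z \<in> S" "z < y" and e: "e \<le> z" "hub S r e" for z e
  proof (cases "z < x")
    case True
    then have "r z < r x"
      using x(1) z e unfolding thin_def by blast
    then show ?thesis using y(3) by simp
  next
    case False
    then have "r z \<le> r x"
      using y_min[of z] z by (cases "z = x") (auto simp: not_less[symmetric])
    then show ?thesis using y(3) by simp
  qed
  then have "y \<in> thin S r"
    using y(1) unfolding thin_def by blast
  then show False
    using x_max y(2) by fastforce
qed

lemma infinite_thin: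
  assumes "infinite S"
    and "\<And>x. x \<in> S \<Longrightarrow> infinite (S \<inter> nbrs r x) \<or> card (S \<inter> nbrs r x) \<le> 1"
  shows "infinite (thin S r)"
proof (cases "\<exists>d. hub S r d")
  case True
  then show ?thesis using infinite_thin_if_hub[OF assms(2)] by blast
next
  case False
  then have "thin S r = S" by (auto simp: thin_def)
  then show ?thesis using assms(1) by simp
qed

text \<open>Here \<open>g\<close> stands for the first digits of \<open>r\<close>; the threshold
  \<open>N\<close> is there because the number for \<open>x\<close> carries only the digits of index
  up to \<open>x\<close>.\<close>

lemma thin_eventually_constant:
  fixes g :: "nat \<Rightarrow> nat"
  assumes "infinite S"
    and "\<And>x. x \<in> S \<Longrightarrow> infinite (S \<inter> nbrs r x) \<or> card (S \<inter> nbrs r x) \<le> 1"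
    and "\<And>x y. N \<le> x \<Longrightarrow> N \<le> y \<Longrightarrow> r x \<le> r y \<Longrightarrow> g x \<le> g y"
    and "\<And>x. g x \<le> B"
  shows "\<exists>c. finite {x \<in> thin S r. g x \<noteq> c}"
proof (cases "\<exists>d. hub S r d")
  case True
  then show ?thesis
    using eventually_constant_on_thin[where N = N and g = g and B = B] infinite_thin assms by blast
next
  case False
  then have "thin S r = S" by (auto simp: thin_def)
  then show ?thesis
    using eventually_constant_if_no_hub[where N = N and g = g and r = r and S = S] False assms(1,3)
    by auto
qed

section \<open>The reduction\<close>

text \<open>\<open>row f i x\<close> has the binary digits \<open>1 A\<^sub>0(x) \<dots> A\<^bsub>i-1\<^esub>(x)\<close> where \<open>f\<close> codes the sequence \<open>A\<close>.\<close>

definition row :: "(nat \<Rightarrow> nat) \<Rightarrow> nat \<Rightarrow> nat \<Rightarrow> nat" where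
  "row f i x = rec_nat 1 (\<lambda>m r. 2 * r + f (prod_encode (m, x))) i"

definition vertex :: "(nat \<Rightarrow> nat) \<Rightarrow> nat \<Rightarrow> nat" where
  "vertex f x = prod_encode (x, row f (Suc x) x)"

text \<open>\<open>prec x p y q\<close> compares the dyadic rationals \<open>p / 2 ^ x\<close> and \<open>q / 2 ^ y\<close>.\<close>

definition prec :: "nat \<Rightarrow> nat \<Rightarrow> nat \<Rightarrow> nat \<Rightarrow> bool" where
  "prec x p y q \<longleftrightarrow> p * 2 ^ y < q * 2 ^ x"

definition edge :: "(nat \<Rightarrow> nat) \<Rightarrow> nat \<Rightarrow> nat \<Rightarrow> bool" where
  "edge f x y \<longleftrightarrow> x < y \<and> prec x (row f (Suc x) x) y (row f (Suc y) y)"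

text \<open>The search for \<open>m\<close> replaces halving the argument. The bounds lose nothing,
  because \<open>x\<close> is at most its vertex and a component is at most the code of its
  pair.\<close>

definition to_graph :: "(nat \<Rightarrow> nat) \<Rightarrow> nat \<Rightarrow> nat" where
  "to_graph f n = of_bool
    ((\<exists>m<Suc n. n = 2 * m \<and> (\<exists>x<Suc m. m = vertex f x)) \<or>
     (\<exists>m<Suc n. n = Suc (2 * m) \<and> (\<exists>x<Suc m. \<exists>y<Suc m. edge f x y \<and>
       (m = prod_encode (vertex f x, vertex f y) \<or> m = prod_encode (vertex f y, vertex f x)))))"

text \<open>\<open>weight h x\<close> recovers \<open>row f (Suc x) x\<close> from \<open>h\<close> if the vertex of \<open>x\<close> is in the set
  with characteristic function \<open>h\<close>, and is \<open>0\<close> otherwise.\<close>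

definition weight :: "(nat \<Rightarrow> nat) \<Rightarrow> nat \<Rightarrow> nat" where
  "weight h x = (\<Sum>n<2 ^ Suc (Suc x). n * of_bool (0 < h (prod_encode (x, n))))"

text \<open>The condition \<open>x < y\<close> is left to the bounded quantifiers of
  \<open>from_solution\<close>. Everything is computed from \<open>h\<close> alone, as a strong
  reduction requires.\<close>

definition arc :: "(nat \<Rightarrow> nat) \<Rightarrow> nat \<Rightarrow> nat \<Rightarrow> bool" where
  "arc h x y \<longleftrightarrow> 0 < weight h x \<and> 0 < weight h y \<and> prec x (weight h x) y (weight h y)"

definition from_solution :: "(nat \<Rightarrow> nat) \<Rightarrow> nat \<Rightarrow> nat" where
  "from_solution h y = of_bool (0 < weight h y \<and>
    (\<forall>z<y. 0 < weight h z \<and> (\<exists>d<Suc z. \<exists>a<d. \<exists>b<a. arc h a d \<and> arc h b d) \<longrightarrow> arc h z y))"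

section \<open>Computability of the two functionals\<close>

lemma computable_row [computable_intros]:
  assumes "computable k a" "computable k b"
  shows "computable k (\<lambda>f xs. row f (a f xs) (b f xs))"
proof -
  have "computable 2 (\<lambda>f xs. row f (hd xs) (hd (tl xs)))"
    unfolding row_def by (intro computable_intros; simp)
  from computable_comp2[OF this assms] show ?thesis .
qed

lemma computable_vertex [computable_intros]:
  "computable k a \<Longrightarrow> computable k (\<lambda>f xs. vertex f (a f xs))"
  unfolding vertex_def by (intro computable_intros)

lemma decidable_edge [computable_intros]:
  assumes "computable k a" "computable k b"
  shows "decidable k (\<lambda>f xs. edge f (a f xs) (b f xs))"
  unfolding edge_def prec_def by (intro computable_intros assms)

lemma turing_functional_to_graph: "turing_functional (\<lambda>f n. Some (to_graph f n))"
  unfolding to_graph_def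
  by (intro turing_functional_if_computable computable_intros; simp)

lemma computable_weight [computable_intros]:
  assumes "computable k a"
  shows "computable k (\<lambda>f xs. weight f (a f xs))"
proof -
  have "computable 1 (\<lambda>f xs. weight f (hd xs))"
    unfolding weight_def by (intro computable_intros; simp)
  from computable_comp1[OF this assms] show ?thesis .
qed

lemma decidable_arc [computable_intros]:
  assumes "computable k a" "computable k b"
  shows "decidable k (\<lambda>f xs. arc f (a f xs) (b f xs))"
  unfolding arc_def prec_def by (intro computable_intros assms)

lemma turing_functional_from_solution: "turing_functional (\<lambda>h n. Some (from_solution h n))"
  unfolding from_solution_def
  by (intro turing_functional_if_computable computable_intros; simp)

text \<open>For 0/1-valued \<open>f\<close> this is \<open>2 + 2 * r\<close> with \<open>r\<close>
  the dyadic rational whose digits after the binary point are those of \<open>x\<close>: an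
  order-preserving change of scale.\<close>

definition ratio :: "(nat \<Rightarrow> nat) \<Rightarrow> nat \<Rightarrow> real" where
  "ratio f x = row f (Suc x) x / 2 ^ x"

lemma prec_iff: "prec x p y q \<longleftrightarrow> real p / 2 ^ x < real q / 2 ^ y"
proof -
  have "prec x p y q \<longleftrightarrow> real (p * 2 ^ y) < real (q * 2 ^ x)"
    unfolding prec_def of_nat_less_iff ..
  also have "\<dots> \<longleftrightarrow> real p / 2 ^ x < real q / 2 ^ y"
    by (simp add: field_simps)
  finally show ?thesis .
qed

section \<open>Rows and their truncations\<close>

lemma row_Suc: "row f (Suc i) x = 2 * row f i x + f (prod_encode (i, x))"
  by (simp add: row_def)

text \<open>The leading digit 1 keeps every row positive, so that a \<open>weight\<close> of 0 can
  signal an absent vertex.\<close>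

lemma row_pos: "0 < row f i x"
  by (induction i) (auto simp: row_def)

lemma row_less:
  assumes "\<And>n. f n \<le> 1"
  shows "row f i x < 2 ^ Suc i"
proof (induction i)
  case (Suc i)
  then show ?case using assms[of "prod_encode (i, x)"] by (simp add: row_Suc)
qed (simp add: row_def)

text \<open>With digits at most 1 no carry occurs, and each halving drops the last digit.\<close>

lemma row_div:
  assumes "\<And>n. f n \<le> 1"
  shows "row f (i + j) x div 2 ^ j = row f i x"
proof (induction j)
  case (Suc j)
  have "row f (i + Suc j) x div 2 ^ Suc j = row f (Suc (i + j)) x div 2 div 2 ^ j"
    by (simp add: div_mult2_eq)
  also have "row f (Suc (i + j)) x div 2 = row f (i + j) x"
    using assms[of "prod_encode (i + j, x)"] by (simp add: row_Suc)
  finally show ?case using Suc by simp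
qed simp

text \<open>Over the common denominator \<open>2 ^ (x + y)\<close>, both numbers are cut after the
  digit of index \<open>i\<close> by the same floor division, which is monotone. Both have this
  digit since \<open>i\<close> is at most \<open>x\<close> and \<open>y\<close>.\<close>

lemma row_mono:
  assumes f: "\<And>n. f n \<le> 1" and "i \<le> x" "i \<le> y" and le: "ratio f x \<le> ratio f y"
  shows "row f (Suc i) x \<le> row f (Suc i) y"
proof -
  have "\<not> prec y (row f (Suc y) y) x (row f (Suc x) x)"
    using le by (simp add: prec_iff ratio_def)
  then have le': "row f (Suc x) x * 2 ^ y \<le> row f (Suc y) y * 2 ^ x"
    by (simp add: prec_def)
  have row: "row f (Suc i) u = row f (Suc u) u * 2 ^ v div 2 ^ (u - i + v)" if "i \<le> u" for u v
  proof -
    have "row f (Suc u) u * 2 ^ v div 2 ^ (u - i + v) = row f (Suc u) u div 2 ^ (u - i)"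
      unfolding power_add by simp
    then show ?thesis
      using row_div[of f "Suc i" "u - i" u, OF f] that by (simp only: add_Suc le_add_diff_inverse)
  qed
  have "x - i + y = y - i + x"
    using assms(2,3) by simp
  then show ?thesis
    using row[OF assms(2), of y] row[OF assms(3), of x] div_le_mono[OF le'] by simp
qed

section \<open>The graph and its code\<close>

lemma inj_vertex: "inj (vertex f)"
  by (auto simp: inj_def vertex_def)

definition graph_edges :: "(nat \<Rightarrow> nat) \<Rightarrow> nat set set" where
  "graph_edges f = {{vertex f x, vertex f y} | x y. edge f x y}"

lemma edge_iff: "edge f x y \<longleftrightarrow> x < y \<and> ratio f x < ratio f y"
  by (simp add: edge_def prec_iff ratio_def)

lemma doubleton_in_graph_edges:
  "{u, v} \<in> graph_edges f \<longleftrightarrow> (\<exists>x y. edge f x y \<and>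
    (u = vertex f x \<and> v = vertex f y \<or> u = vertex f y \<and> v = vertex f x))"
  unfolding graph_edges_def mem_Collect_eq doubleton_eq_iff by blast

lemma graph_edges_iff:
  "{vertex f x, vertex f y} \<in> graph_edges f \<longleftrightarrow> y \<in> nbrs (ratio f) x"
  by (auto simp: graph_edges_def doubleton_eq_iff edge_iff nbrs_def inj_eq[OF inj_vertex])

lemma inf_graph_graph_edges: "inf_graph (range (vertex f)) (graph_edges f)"
  by (auto simp: inf_graph_def graph_edges_def edge_iff inj_eq[OF inj_vertex]
      range_inj_infinite[OF inj_vertex])

lemma le_vertex: "x \<le> vertex f x"
  by (simp add: vertex_def le_prod_encode_1)

lemma to_graph_eq: "to_graph f = graph_code (range (vertex f)) (graph_edges f)"
proof
  fix n
  have vertex: "m \<in> range (vertex f) \<longleftrightarrow> (\<exists>x<Suc m. m = vertex f x)" for m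
    using le_vertex by (auto simp: less_Suc_eq_le)
  have edge: "m \<in> {prod_encode (u, v) | u v. {u, v} \<in> graph_edges f} \<longleftrightarrow>
      (\<exists>x<Suc m. \<exists>y<Suc m. edge f x y \<and>
       (m = prod_encode (vertex f x, vertex f y) \<or> m = prod_encode (vertex f y, vertex f x)))" for m
  proof -
    have "x < Suc (prod_encode (vertex f x, v))" "x < Suc (prod_encode (v, vertex f x))" for x v
      unfolding less_Suc_eq_le
      by (meson le_vertex le_prod_encode_1 le_prod_encode_2 order_trans)+
    then have bound: "x < Suc m \<and> y < Suc m" if "m = prod_encode (vertex f x, vertex f y) \<or>
        m = prod_encode (vertex f y, vertex f x)" for x y
      using that by blast
    have "m \<in> {prod_encode (u, v) | u v. {u, v} \<in> graph_edges f} \<longleftrightarrow> (\<exists>x y. edge f x y \<and>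
        (m = prod_encode (vertex f x, vertex f y) \<or> m = prod_encode (vertex f y, vertex f x)))"
      unfolding doubleton_in_graph_edges by blast
    with bound show ?thesis
      by blast
  qed
  \<comment> \<open>Parity selects one disjunct of \<open>to_graph\<close> and determines the half
    that is searched for.\<close>
  have even_odd: "(\<exists>k<Suc (2 * m). 2 * m = 2 * k \<and> P k) \<longleftrightarrow> P m"
      "(\<exists>k<Suc (2 * m). 2 * m = Suc (2 * k) \<and> P k) \<longleftrightarrow> False"
      "(\<exists>k<Suc (Suc (2 * m)). Suc (2 * m) = 2 * k \<and> P k) \<longleftrightarrow> False"
      "(\<exists>k<Suc (Suc (2 * m)). Suc (2 * m) = Suc (2 * k) \<and> P k) \<longleftrightarrow> P m" for m :: nat and P
    by auto presburger+
  obtain m where m: "n = 2 * m \<or> n = Suc (2 * m)"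
    by (metis evenE oddE Suc_eq_plus1)
  then show "to_graph f n = graph_code (range (vertex f)) (graph_edges f) n"
  proof
    assume n: "n = 2 * m"
    show ?thesis
      unfolding to_graph_def n even_odd vertex[symmetric]
      by (simp add: graph_code_def join_def char_fun_def)
  next
    assume n: "n = Suc (2 * m)"
    show ?thesis
      unfolding to_graph_def n even_odd edge[symmetric]
      by (simp add: graph_code_def join_def char_fun_def)
  qed
qed

section \<open>Solutions and their decoding\<close>

lemma char_fun_inject: "char_fun A = char_fun B \<longleftrightarrow> A = B"
  by (auto simp: char_fun_def fun_eq_iff)

text \<open>A solution in \<open>wRSg\<close> comes with some graph of the given code, which has to
  be identified with the constructed one; of \<open>E\<close> the code records exactly the sets
  \<open>{x, y}\<close>.\<close>

lemma graph_code_inject: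
  assumes "graph_code V E = graph_code V' E'"
  shows "V = V'" "{x, y} \<in> E \<longleftrightarrow> {x, y} \<in> E'"
proof -
  have "char_fun V n = char_fun V' n" for n
    using fun_cong[OF assms, of "2 * n"] by (simp add: graph_code_def join_def)
  then show "V = V'"
    by (auto simp: fun_eq_iff simp flip: char_fun_inject)
  show "{x, y} \<in> E \<longleftrightarrow> {x, y} \<in> E'"
    using fun_cong[OF assms, of "Suc (2 * prod_encode (x, y))"]
    by (simp add: graph_code_def join_def char_fun_def of_bool_eq_iff)
qed

text \<open>An infinite homogeneous set from Ramsey's theorem is a solution: an independent set
  leaves no neighbours, a clique leaves all other elements.\<close>

lemma wRSg_nonempty:
  assumes "inf_graph V E"
  shows "wRSg (graph_code V E) \<noteq> {}"
proof -
  have "infinite V"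
    using assms by (simp add: inf_graph_def)
  moreover have "\<forall>x\<in>V. \<forall>y\<in>V. x \<noteq> y \<longrightarrow> of_bool ({x, y} \<in> E) < (2 :: nat)"
    by (simp add: of_bool_def)
  ultimately obtain H t where H: "H \<subseteq> V" "infinite H"
    and hom: "\<forall>x\<in>H. \<forall>y\<in>H. x \<noteq> y \<longrightarrow> of_bool ({x, y} \<in> E) = (t :: nat)"
    using Ramsey2[of V "\<lambda>e. of_bool (e \<in> E)" 2] by blast
  \<comment> \<open>Homogeneity says nothing about \<open>x = y\<close>, so simplicity of the graph
    must keep a vertex out of its own neighbourhood.\<close>
  have loop: "{v} \<notin> E" for v
    using assms by (auto simp: inf_graph_def nsets_def)
  have "infinite (H \<inter> nbhd E v) \<or> card (H \<inter> nbhd E v) \<le> 1" if v: "v \<in> H" for v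
  proof (cases "t = 0")
    case True
    then have "H \<inter> nbhd E v = {}"
      using hom v loop[of v] by (auto simp: nbhd_def) (metis insert_absorb2 of_bool_eq_0_iff)
    then show ?thesis by simp
  next
    case False
    then have "H - {v} \<subseteq> H \<inter> nbhd E v"
      using hom v by (fastforce simp: nbhd_def)
    then show ?thesis
      using H(2) by (meson finite_Diff2 finite_subset finite.intros)
  qed
  then have "char_fun H \<in> wRSg (graph_code V E)"
    using assms H unfolding wRSg_def by blast
  then show ?thesis by blast
qed

text \<open>Each \<open>x\<close> has just one vertex, so at most one term of the sum survives; its
  index is the row, which \<open>row_less\<close> places in the range of the sum.\<close>

lemma weight_char_fun:
  assumes "\<And>n. f n \<le> 1" "H \<subseteq> range (vertex f)"
  shows "weight (char_fun H) x = (if vertex f x \<in> H then row f (Suc x) x else 0)"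
proof -
  have "n * of_bool (0 < char_fun H (prod_encode (x, n))) =
      (if n = row f (Suc x) x then n * of_bool (vertex f x \<in> H) else 0)" for n
    using assms(2) by (auto simp: char_fun_def vertex_def)
  then show ?thesis
    using row_less[of f "Suc x" x, OF assms(1)] by (simp add: weight_def)
qed

lemma from_solution_char_fun:
  assumes "\<And>n. f n \<le> 1" "H \<subseteq> range (vertex f)"
  shows "from_solution (char_fun H) = char_fun (thin {x. vertex f x \<in> H} (ratio f))"
proof
  fix y
  let ?S = "{x. vertex f x \<in> H}"
  note weight = weight_char_fun[OF assms]
  have pos: "0 < weight (char_fun H) x \<longleftrightarrow> x \<in> ?S" for x
    by (simp add: weight row_pos)
  have arc: "arc (char_fun H) x y \<longleftrightarrow> x \<in> ?S \<and> y \<in> ?S \<and> ratio f x < ratio f y" for x y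
    by (auto simp: arc_def pos) (auto simp: weight prec_iff ratio_def)
  have hub: "(\<exists>a<d. \<exists>b<a. arc (char_fun H) a d \<and> arc (char_fun H) b d) \<longleftrightarrow> hub ?S (ratio f) d" for d
    by (auto simp: arc hub_def)
  show "from_solution (char_fun H) y = char_fun (thin ?S (ratio f)) y"
    unfolding from_solution_def hub pos less_Suc_eq_le
    by (auto simp: char_fun_def thin_def arc)
qed

theorem theorem6p9: "COH \<le>\<^sub>s\<^sub>W wRSg"
proof -
  have "\<exists>k\<in>COH f. (\<lambda>n. Some (from_solution h n)) = Some \<circ> k"
    if f: "f \<in> pdom COH" and h: "h \<in> wRSg (to_graph f)" for f h
  proof -
    obtain A where A: "f = seq_code A"
      using f by (auto simp: pdom_def COH_def)
    have f_le: "f n \<le> 1" for n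
      by (simp add: A seq_code_def char_fun_def)
    obtain H V E where H: "h = char_fun H" "infinite H" "H \<subseteq> V"
      and code: "to_graph f = graph_code V E"
      and sol: "\<And>v. v \<in> H \<Longrightarrow> infinite (H \<inter> nbhd E v) \<or> card (H \<inter> nbhd E v) \<le> 1"
      using h unfolding wRSg_def by blast
    have V: "H \<subseteq> range (vertex f)"
      and E: "{u, v} \<in> E \<longleftrightarrow> {u, v} \<in> graph_edges f" for u v
      using graph_code_inject[OF code[unfolded to_graph_eq]] H(3) by auto
    define S where "S = {x. vertex f x \<in> H}"
    have H_eq: "H = vertex f ` S"
      using V by (auto simp: S_def)
    have "H \<inter> nbhd E (vertex f x) = vertex f ` (S \<inter> nbrs (ratio f) x)" for x
      by (auto simp: H_eq nbhd_def E graph_edges_iff)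
    then have sol': "infinite (S \<inter> nbrs (ratio f) x) \<or> card (S \<inter> nbrs (ratio f) x) \<le> 1"
      if "x \<in> S" for x
      using sol[of "vertex f x"] that inj_on_subset[OF inj_vertex subset_UNIV]
      by (simp add: H_eq card_image finite_image_iff)
    have inf: "infinite S"
      using H(2) by (auto simp: H_eq)
    let ?C = "thin S (ratio f)"
    have "finite (?C - A i) \<or> finite (?C \<inter> A i)" for i
    proof -
      \<comment> \<open>Truncation after digit \<open>i\<close> is monotone in
        \<open>ratio f\<close> from \<open>i\<close> on and bounded, so it stabilises.\<close>
      obtain c where c: "finite {x \<in> ?C. row f (Suc i) x \<noteq> c}"
        using thin_eventually_constant[where g = "row f (Suc i)" and N = i, OF inf sol' row_mono[OF f_le]
          less_imp_le[OF row_less[OF f_le]]] by blast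
      \<comment> \<open>The last digit of this row tells whether \<open>x\<close> is in
        \<open>A i\<close>. Elements whose digit differs from the parity of \<open>c\<close> are
        exceptional, so one of the two sets is finite.\<close>
      have "row f (Suc i) x mod 2 = of_bool (x \<in> A i)" for x
        by (simp add: row_Suc A seq_code_def char_fun_def)
      then have "row f (Suc i) x \<noteq> c" if "x \<in> A i \<longleftrightarrow> c mod 2 = 0" for x
        using that by (metis of_bool_eq(1,2) zero_neq_one)
      then have "?C - A i \<subseteq> {x \<in> ?C. row f (Suc i) x \<noteq> c} \<or>
          ?C \<inter> A i \<subseteq> {x \<in> ?C. row f (Suc i) x \<noteq> c}"
        by blast
      then show ?thesis
        using c finite_subset by blast
    qed
    then have "char_fun ?C \<in> COH f"
      using infinite_thin[OF inf sol'] A unfolding COH_def by blast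
    moreover have "from_solution h = char_fun ?C"
      using from_solution_char_fun[OF f_le V] by (simp add: H(1) S_def)
    ultimately show ?thesis
      by (auto simp: fun_eq_iff)
  qed
  moreover have "to_graph f \<in> pdom wRSg" for f
    using wRSg_nonempty[OF inf_graph_graph_edges] by (simp add: pdom_def to_graph_eq)
  moreover have "(\<lambda>n. Some (to_graph f n)) = Some \<circ> to_graph f" for f
    by auto
  ultimately show ?thesis
    unfolding sW_reducible_def
    using turing_functional_to_graph turing_functional_from_solution by blast
qed

end
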